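(* Let $c^{\ell,n}>0$ (componentwise, $\ell=1,\dots,M$) and $\boldsymbol{D}^n$ be given. If the time step $\Delta t>0$ and the space step $h>0$ satisfy $$\frac{\Delta t}{h^2}<\frac{1}{16\,\kappa\, B\!\left(-\max_{i,j,\ell}\left\{|dg^{\ell,n}_{i+1/2,j}|,\ |dg^{\ell,n}_{i,j+1/2}|\right\}\right)}$$ and $$\left(\frac{4\kappa}{h^2}+\frac{\lambda}{4}\right)\Delta t<\frac{\alpha_{\min}}{4+2\alpha_{\min}},$$ then the solution $c^{\ell,n+1}$ of the implicit ETD1 scheme $$c^{\ell,n+1}=c^{\ell,n}+\Delta t\, f_e(\Delta t L_h)\,M_h^{\ell,n}\,c^{\ell,n+1}$$ satisfies $c^{\ell,n+1}>0$ (componentwise) for $\ell=1,\dots,M$.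
   Context: Mesh. $\Omega=(0,L_x)\times(0,L_y)$ is covered by a uniform grid of size $h=L_x/N_x=L_y/N_y$. Cell-centered grid functions $\phi=(\phi_{i,j})$, $1\le i\le N_x$, $1\le j\le N_y$, are extended periodically in both indices and identified with vectors in $\mathbb{R}^{N_xN_y}$; linear operators on them are identified with matrices. Face-centered quantities carry indices $(i+\frac12,j)$ and $(i,j+\frac12)$ and are also periodic. Discrete Laplacian: $(\Delta_h\phi)_{i,j}=h^{-2}(\phi_{i+1,j}+\phi_{i-1,j}+\phi_{i,j+1}+\phi_{i,j-1}-4\phi_{i,j})$. Parameters: $\kappa>0$; stabilizer $\lambda>0$; valences $q^\ell$; dielectric coefficient $\varepsilon>0$ with face values $\varepsilon_{i+1/2,j},\varepsilon_{i,j+1/2}$. Define $L_h=-\kappa\Delta_h+\lambda I$, and $f_e(x)=(1-e^{-x})/x$ for $x\ne0$, $f_e(0)=1$; $f_e(\Delta tL_h)$ is the matrix function. Data at time $t_n$: cell-centered concentrations $c^{\ell,n}$, $\ell=1,\dots,M$; a face-centered electric displacement $\boldsymbol{D}^n$ with components $D^n_{i+1/2,j}$, $D^n_{i,j+1/2}$; and the cell-centered excess chemical potentials $$\mu^{\ell,\mathrm{cr},n}=-\frac{v^\ell}{v^0}\log\left(v^0c^{0,n}\right)+\frac{\chi (q^\ell)^2}{a^\ell}\left(\frac1\varepsilon-1\right),\qquad c^{0,n}=\Big(1-\sum_{\ell=1}^Mv^\ell c^{\ell,n}\Big)/v^0,$$ where $v^\ell,v^0$ are the ion and solvent volumes, $a^\ell$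 the Born radii, $\chi$ a constant (it is understood that $c^{0,n}>0$ so that this is defined). Put $$dg^{\ell,n}_{i+1/2,j}=-hq^\ell\frac{D^n_{i+1/2,j}}{\varepsilon_{i+1/2,j}}+\mu^{\ell,\mathrm{cr},n}_{i+1,j}-\mu^{\ell,\mathrm{cr},n}_{i,j},\qquad dg^{\ell,n}_{i,j+1/2}=-hq^\ell\frac{D^n_{i,j+1/2}}{\varepsilon_{i,j+1/2}}+\mu^{\ell,\mathrm{cr},n}_{i,j+1}-\mu^{\ell,\mathrm{cr},n}_{i,j}.$$ Bernoulli function: $B(z)=z/(e^z-1)$ for $z\neq0$, $B(0)=1$. The matrix $M_h^{\ell,n}$ is defined on cell-centered periodic $f$ by $$(M_h^{\ell,n}f)_{i,j}=-\frac1h\left(J_{i+1/2,j}-J_{i-1/2,j}\right)-\frac1h\left(J_{i,j+1/2}-J_{i,j-1/2}\right),$$ $$J_{i+1/2,j}=-\frac{\kappa}{h}\left[B(-dg^{\ell,n}_{i+1/2,j})f_{i+1,j}-B(dg^{\ell,n}_{i+1/2,j})f_{i,j}\right],\quad J_{i,j+1/2}=-\frac{\kappa}{h}\left[B(-dg^{\ell,n}_{i,j+1/2})f_{i,j+1}-B(dg^{\ell,n}_{i,j+1/2})f_{i,j}\right].$$ The number $\alpha_{\min}$ is the smallest entry of the inverse matrices $(I-\Delta t M_h^{\ell,n})^{-1}$: $$\alpha_{\min}=\min_{\ell}\min_{r,s}\left[(I-\Delta tM_h^{\ell,n})^{-1}\right]_{r,s}.$$ It is a known fact that $I-\Delta tM_h^{\ell,n}$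 is an M-matrix with entrywise positive inverse, so $\alpha_{\min}>0$. *)

theory Defs
  imports "HOL-Analysis.Analysis" "Berlekamp_Zassenhaus.Finite_Field"
begin

section \<open>Periodic grid functions\<close>

text \<open>
  A cell \<open>(i, j)\<close> is a pair of residues modulo \<open>N\<^sub>x = CARD('x)\<close> and \<open>N\<^sub>y = CARD('y)\<close>, so
  periodicity in both indices is built into the index type.  The unit step is written
  \<open>of_int_mod_ring 1\<close> because the type class providing the numeral \<open>1\<close> on \<open>'x mod_ring\<close>
  excludes \<open>CARD('x) = 1\<close>.

  Face-centred quantities are stored at the cell to their left (resp. below): the entry \<open>(i, j)\<close>
  of an x-face grid is the value at \<open>(i + 1/2, j)\<close>, the entry \<open>(i, j)\<close> of a y-face grid is the
  value at \<open>(i, j + 1/2)\<close>.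
\<close>

type_synonym ('x, 'y) cell = "'x mod_ring \<times> 'y mod_ring"
type_synonym ('x, 'y) grid = "real ^ ('x, 'y) cell"
type_synonym ('x, 'y) grid_matrix = "real ^ ('x, 'y) cell ^ ('x, 'y) cell"

definition east :: "('x::finite, 'y::finite) cell \<Rightarrow> ('x, 'y) cell" where
  "east p = (fst p + of_int_mod_ring 1, snd p)"

definition west :: "('x::finite, 'y::finite) cell \<Rightarrow> ('x, 'y) cell" where
  "west p = (fst p - of_int_mod_ring 1, snd p)"

definition north :: "('x::finite, 'y::finite) cell \<Rightarrow> ('x, 'y) cell" where
  "north p = (fst p, snd p + of_int_mod_ring 1)"

definition south :: "('x::finite, 'y::finite) cell \<Rightarrow> ('x, 'y) cell" where
  "south p = (fst p, snd p - of_int_mod_ring 1)"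

definition discrete_laplacian ::
  "real \<Rightarrow> ('x::finite, 'y::finite) grid \<Rightarrow> ('x, 'y) grid" where
  "discrete_laplacian h \<phi> = (\<chi> p. (\<phi> $ east p + \<phi> $ west p + \<phi> $ north p + \<phi> $ south p
      - 4 * \<phi> $ p) / h\<^sup>2)"

definition L_h :: "real \<Rightarrow> real \<Rightarrow> real \<Rightarrow> ('x::finite, 'y::finite) grid_matrix" where
  "L_h \<kappa> stab h = - \<kappa> *\<^sub>R matrix (discrete_laplacian h) + stab *\<^sub>R mat 1"


section \<open>Matrix functions\<close>

text \<open>
  The operation \<open>^\<close> on the vector type acts componentwise, hence a separate matrix power.
\<close>

primrec matrix_power :: "real ^ 'n ^ 'n \<Rightarrow> nat \<Rightarrow> real ^ 'n ^ 'n" where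
  "matrix_power A 0 = mat 1"
| "matrix_power A (Suc k) = A ** matrix_power A k"

text \<open>
  The matrix function \<open>f(A) = \<Sum>k. f\<^sup>(\<^sup>k\<^sup>)(0) / k! A\<^sup>k\<close> of a function \<open>f\<close> that is the sum of its
  Taylor series at \<open>0\<close> on the whole real line; lemma \<open>f_e_Taylor\<close> below shows that \<open>f_e\<close> is such
  a function.
\<close>

definition matrix_function :: "(real \<Rightarrow> real) \<Rightarrow> real ^ 'n ^ 'n \<Rightarrow> real ^ 'n ^ 'n" where
  "matrix_function f A = (\<Sum>k. ((deriv ^^ k) f 0 / fact k) *\<^sub>R matrix_power A k)"

definition f_e :: "real \<Rightarrow> real" where
  "f_e x = (if x = 0 then 1 else (1 - exp (- x)) / x)"

lemma f_e_sums: "(\<lambda>k. (- 1) ^ k / fact (Suc k) * x ^ k) sums f_e x"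
proof (cases "x = 0")
  case True
  then show ?thesis
    using powser_sums_zero[of "\<lambda>k. (- 1) ^ k / fact (Suc k) :: real"] by (simp add: f_e_def)
next
  case False
  have "(\<lambda>k. (- x) ^ k / fact k) sums exp (- x)"
    using exp_converges[of "- x"] by (simp add: field_simps scaleR_conv_of_real)
  then have "(\<lambda>k. (- x) ^ Suc k / fact (Suc k)) sums (exp (- x) - 1)"
    by (subst sums_Suc_iff) simp
  then have "(\<lambda>k. (- x) ^ Suc k / fact (Suc k) * (- 1 / x)) sums ((exp (- x) - 1) * (- 1 / x))"
    by (rule sums_mult2)
  moreover have "(exp (- x) - 1) * (- 1 / x) = (1 - exp (- x)) / x"
    by (simp add: algebra_simps diff_divide_distrib)
  moreover have "(- x) ^ Suc k / fact (Suc k) * (- 1 / x) = (- 1) ^ k / fact (Suc k) * x ^ k" for k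
    using False by (simp add: power_minus[of x] field_simps del: fact_Suc)
  ultimately show ?thesis
    using False by (simp only: f_e_def if_False)
qed

lemma higher_deriv_powser_0:
  fixes c :: "nat \<Rightarrow> real"
  assumes "\<And>x. summable (\<lambda>n. c n * x ^ n)"
  shows "(deriv ^^ k) (\<lambda>x. \<Sum>n. c n * x ^ n) 0 = fact k * c k"
proof -
  have "(deriv ^^ k) (\<lambda>x. \<Sum>n. c n * x ^ n) = (\<lambda>x. \<Sum>n. (diffs ^^ k) c n * x ^ n)
      \<and> (\<forall>x. summable (\<lambda>n. (diffs ^^ k) c n * x ^ n))"
  proof (induction k)
    case 0
    then show ?case using assms by simp
  next
    case (Suc k)
    let ?c = "(diffs ^^ k) c"
    have s: "summable (\<lambda>n. ?c n * x ^ n)" for x using Suc by blast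
    have "((\<lambda>x. \<Sum>n. ?c n * x ^ n) has_field_derivative (\<Sum>n. diffs ?c n * x ^ n)) (at x)" for x
      by (rule termdiffs_strong_converges_everywhere[OF s])
    then have "deriv (\<lambda>x. \<Sum>n. ?c n * x ^ n) = (\<lambda>x. \<Sum>n. diffs ?c n * x ^ n)"
      by (intro ext DERIV_imp_deriv)
    moreover have "summable (\<lambda>n. diffs ?c n * x ^ n)" for x
      by (rule termdiff_converges_all[OF s])
    ultimately show ?case using Suc by simp
  qed
  moreover have "(diffs ^^ k) c n = fact (n + k) / fact n * c (n + k)" for n
  proof (induction k arbitrary: n)
    case (Suc k)
    have "(diffs ^^ Suc k) c n = of_nat (Suc n) * (fact (Suc n + k) / fact (Suc n) * c (Suc n + k))"
      by (simp only: Suc.IH[of "Suc n"] funpow.simps o_apply diffs_def)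
    also have "\<dots> = fact (n + Suc k) / fact n * c (n + Suc k)"
      by (subst fact_Suc[of n]) (simp del: of_nat_Suc fact_Suc)
    finally show ?case .
  qed simp
  ultimately show ?thesis
    using powser_zero[of "(diffs ^^ k) c"] by (simp del: powser_zero)
qed

lemma f_e_deriv: "(deriv ^^ k) f_e 0 = (- 1) ^ k * fact k / fact (Suc k)"
proof -
  have "f_e = (\<lambda>x. \<Sum>k. (- 1) ^ k / fact (Suc k) * x ^ k)"
    using f_e_sums by (intro ext) (rule sums_unique)
  then show ?thesis
    using higher_deriv_powser_0[of "\<lambda>k. (- 1) ^ k / fact (Suc k)" k] f_e_sums
    by (auto simp: sums_iff simp del: fact_Suc)
qed

lemma f_e_Taylor: "(\<lambda>k. (deriv ^^ k) f_e 0 / fact k * x ^ k) sums f_e x"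
  using f_e_sums[of x] by (simp add: f_e_deriv del: fact_Suc)


section \<open>Chemical potentials and the generator\<close>

definition solvent_concentration ::
  "('l::finite \<Rightarrow> real) \<Rightarrow> real \<Rightarrow> ('l \<Rightarrow> ('x::finite, 'y::finite) grid) \<Rightarrow> ('x, 'y) grid" where
  "solvent_concentration v v0 c = (\<chi> p. (1 - (\<Sum>l\<in>UNIV. v l * c l $ p)) / v0)"

text \<open>
  The dielectric coefficient may vary in space; here \<open>\<epsilon>\<close> holds its values at the cell centres.
\<close>

definition excess_potential ::
  "('l::finite \<Rightarrow> real) \<Rightarrow> real \<Rightarrow> real \<Rightarrow> ('l \<Rightarrow> real) \<Rightarrow> ('l \<Rightarrow> real)
    \<Rightarrow> ('x::finite, 'y::finite) grid \<Rightarrow> ('l \<Rightarrow> ('x, 'y) grid) \<Rightarrow> 'l \<Rightarrow> ('x, 'y) grid" where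
  "excess_potential v v0 chi0 q a \<epsilon> c l = (\<chi> p.
      - (v l / v0) * ln (v0 * solvent_concentration v v0 c $ p)
      + chi0 * (q l)\<^sup>2 / a l * (1 / \<epsilon> $ p - 1))"

definition dg_x ::
  "real \<Rightarrow> real \<Rightarrow> ('x::finite, 'y::finite) grid \<Rightarrow> ('x, 'y) grid \<Rightarrow> ('x, 'y) grid \<Rightarrow> ('x, 'y) grid" where
  "dg_x h ql Dx \<epsilon>x \<mu> = (\<chi> p. - h * ql * (Dx $ p / \<epsilon>x $ p) + \<mu> $ east p - \<mu> $ p)"

definition dg_y ::
  "real \<Rightarrow> real \<Rightarrow> ('x::finite, 'y::finite) grid \<Rightarrow> ('x, 'y) grid \<Rightarrow> ('x, 'y) grid \<Rightarrow> ('x, 'y) grid" where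
  "dg_y h ql Dy \<epsilon>y \<mu> = (\<chi> p. - h * ql * (Dy $ p / \<epsilon>y $ p) + \<mu> $ north p - \<mu> $ p)"

definition Bernoulli :: "real \<Rightarrow> real" where
  "Bernoulli z = (if z = 0 then 1 else z / (exp z - 1))"

definition flux_x ::
  "real \<Rightarrow> real \<Rightarrow> ('x::finite, 'y::finite) grid \<Rightarrow> ('x, 'y) grid \<Rightarrow> ('x, 'y) grid" where
  "flux_x \<kappa> h dgx f = (\<chi> p. - (\<kappa> / h)
      * (Bernoulli (- (dgx $ p)) * f $ east p - Bernoulli (dgx $ p) * f $ p))"

definition flux_y ::
  "real \<Rightarrow> real \<Rightarrow> ('x::finite, 'y::finite) grid \<Rightarrow> ('x, 'y) grid \<Rightarrow> ('x, 'y) grid" where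
  "flux_y \<kappa> h dgy f = (\<chi> p. - (\<kappa> / h)
      * (Bernoulli (- (dgy $ p)) * f $ north p - Bernoulli (dgy $ p) * f $ p))"

definition M_h ::
  "real \<Rightarrow> real \<Rightarrow> ('x::finite, 'y::finite) grid \<Rightarrow> ('x, 'y) grid \<Rightarrow> ('x, 'y) grid_matrix" where
  "M_h \<kappa> h dgx dgy = matrix (\<lambda>f. \<chi> p.
      - (1 / h) * (flux_x \<kappa> h dgx f $ p - flux_x \<kappa> h dgx f $ west p)
      - (1 / h) * (flux_y \<kappa> h dgy f $ p - flux_y \<kappa> h dgy f $ south p))"

definition alpha_min ::
  "real \<Rightarrow> ('l::finite \<Rightarrow> ('x::finite, 'y::finite) grid_matrix) \<Rightarrow> real" where
  "alpha_min \<Delta>t M = Min {matrix_inv (mat 1 - \<Delta>t *\<^sub>R M l) $ r $ s | l r s. True}"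

text \<open>
  \<open>matrix\<close> represents a map faithfully only if the map is linear.
\<close>

lemma L_h_mult:
  fixes f :: "('x::finite, 'y::finite) grid"
  shows "L_h \<kappa> stab h *v f = - \<kappa> *\<^sub>R discrete_laplacian h f + stab *\<^sub>R f"
proof -
  have "linear (discrete_laplacian h :: ('x, 'y) grid \<Rightarrow> _)"
    by (rule linearI) (simp_all add: discrete_laplacian_def vec_eq_iff add_divide_distrib
        diff_divide_distrib ring_distribs mult.left_commute)
  then have "matrix (discrete_laplacian h) *v f = discrete_laplacian h f"
    by (simp add: matrix_works)
  then show ?thesis
    unfolding L_h_def
    by (simp only: matrix_vector_mult_add_rdistrib scaleR_matrix_vector_assoc[symmetric]
        matrix_vector_mul_lid)
qed

lemma M_h_mult:
  "(M_h \<kappa> h dgx dgy *v f) $ p =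
      - (1 / h) * (flux_x \<kappa> h dgx f $ p - flux_x \<kappa> h dgx f $ west p)
      - (1 / h) * (flux_y \<kappa> h dgy f $ p - flux_y \<kappa> h dgy f $ south p)"
proof -
  have "linear (\<lambda>f. \<chi> p. - (1 / h) * (flux_x \<kappa> h dgx f $ p - flux_x \<kappa> h dgx f $ west p)
      - (1 / h) * (flux_y \<kappa> h dgy f $ p - flux_y \<kappa> h dgy f $ south p))"
    by (rule linearI) (simp_all add: flux_x_def flux_y_def vec_eq_iff algebra_simps)
  then show ?thesis
    by (simp add: M_h_def matrix_works)
qed

end

theory Submission
  imports Defs
begin

text \<open>
  Fix a species, write \<open>M\<close> for its transport matrix, \<open>\<lambda>\<close> for the stabilizer,
  \<open>S = f\<^sub>e(\<Delta>t L\<^sub>h)\<close>, \<open>P = (I - \<Delta>t M)\<^sup>-\<^sup>1\<close>, and \<open>u\<close> for the new concentration.  If \<open>S\<close> were the identity, the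
  scheme would be implicit Euler, \<open>u = P c\<close>, and \<open>u\<close> would be positive because \<open>P\<close> is.  The proof
  shows that \<open>S\<close> is so close to the identity that the positivity of \<open>P\<close> absorbs the difference.

  Everything is measured in the \<open>\<ell>\<^sup>1\<close> norm, the one suited to conservation of mass.  The flux
  form makes \<open>M\<close> the generator of a Markov chain acting on densities: nonnegative off-diagonal
  entries and vanishing column sums.  Hence \<open>I - \<Delta>t M\<close> does not decrease the \<open>\<ell>\<^sup>1\<close> norm
  (\<open>l1_norm_le_implicit_euler\<close>), and \<open>P\<close> exists, is nonnegative and has column sums \<open>1\<close>
  (\<open>implicit_euler_inverse_stochastic\<close>).

  Put \<open>y = (I - \<Delta>t M) u\<close>.  Then \<open>u = P y\<close> and the increment \<open>\<Delta>t M u\<close> equals \<open>P y - y\<close>, so the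
  scheme reads \<open>y = c - (I - S)(P - I) y\<close>.  With \<open>\<alpha>\<close> a lower bound for the entries of \<open>P\<close>,
  \<^item> \<open>P - I\<close> has \<open>\<ell>\<^sup>1\<close> operator norm at most \<open>2 (1 - \<alpha>)\<close>, because the columns of \<open>P\<close> are
    probability vectors with diagonal entry at least \<open>\<alpha>\<close>;
  \<^item> \<open>I - S\<close> has norm at most \<open>x / (2 - x)\<close>, where \<open>x = \<Delta>t (8 \<kappa> / h\<^sup>2 + \<lambda>)\<close> bounds the norm of
    \<open>\<Delta>t L\<^sub>h\<close>: compare the power series of \<open>f\<^sub>e\<close> with a geometric series
    (\<open>l1_norm_diff_matrix_function_f_e_le\<close>).

  Thus \<open>w = c - y\<close> is small relative to \<open>c\<close>.  In \<open>u = P c - P w\<close> each component of \<open>P c\<close> is at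
  least \<open>\<alpha> |c|\<^sub>1\<close>, and no component of \<open>P w\<close> exceeds \<open>|w|\<^sub>1\<close>, since the entries of \<open>P\<close> are at
  most \<open>1\<close>.  So \<open>|w|\<^sub>1 < \<alpha> |c|\<^sub>1\<close> suffices (\<open>perturbed_implicit_euler_positive\<close>), and this
  is what the time step bound \<open>(4 \<kappa> / h\<^sup>2 + \<lambda> / 4) \<Delta>t < \<alpha> / (4 + 2 \<alpha>)\<close> yields.  The bound also
  forces \<open>\<alpha> > 0\<close>: its left side is positive, and \<open>\<alpha> \<ge> 0\<close> because \<open>P\<close> is nonnegative.
\<close>

section \<open>The discrete L1 norm\<close>

definition l1_norm :: "real ^ 'n \<Rightarrow> real" where
  "l1_norm v = (\<Sum>i\<in>UNIV. \<bar>v $ i\<bar>)"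

lemma l1_norm_nonneg: "l1_norm v \<ge> 0"
  by (simp add: l1_norm_def sum_nonneg)

lemma abs_component_le_l1_norm: "\<bar>v $ i\<bar> \<le> l1_norm v"
  unfolding l1_norm_def by (rule member_le_sum) auto

lemma l1_norm_zero [simp]: "l1_norm 0 = 0"
  by (simp add: l1_norm_def)

lemma l1_norm_eq_0_iff: "l1_norm v = 0 \<longleftrightarrow> v = 0"
  by (simp add: l1_norm_def sum_nonneg_eq_0_iff vec_eq_iff)

lemma l1_norm_triangle: "l1_norm (v + w) \<le> l1_norm v + l1_norm w"
  unfolding l1_norm_def by (simp add: sum.distrib[symmetric] sum_mono abs_triangle_ineq)

lemma l1_norm_scaleR: "l1_norm (a *\<^sub>R v) = \<bar>a\<bar> * l1_norm v"
  by (simp add: l1_norm_def abs_mult sum_distrib_left)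

lemma l1_norm_diff: "l1_norm (v - w) \<le> l1_norm v + l1_norm w"
  using l1_norm_triangle[of v "- 1 *\<^sub>R w"] l1_norm_scaleR[of "- 1" w] by simp

lemma l1_norm_sum: "l1_norm (\<Sum>k\<in>K. f k) \<le> (\<Sum>k\<in>K. l1_norm (f k))"
  by (induction K rule: infinite_finite_induct) (auto intro: order_trans[OF l1_norm_triangle])

lemma l1_norm_axis: "l1_norm (axis s 1) = 1"
  by (simp add: l1_norm_def axis_def if_distrib cong: if_cong)

lemma l1_norm_matrix_vector_mult_le:
  assumes "\<And>s. (\<Sum>r\<in>UNIV. \<bar>A $ r $ s\<bar>) \<le> C"
  shows "l1_norm (A *v v) \<le> C * l1_norm v"
proof -
  have "l1_norm (A *v v) \<le> (\<Sum>r\<in>UNIV. \<Sum>s\<in>UNIV. \<bar>A $ r $ s\<bar> * \<bar>v $ s\<bar>)"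
    unfolding l1_norm_def matrix_vector_mult_def
    by (auto intro!: sum_mono order_trans[OF sum_abs] simp: abs_mult)
  also have "\<dots> = (\<Sum>s\<in>UNIV. (\<Sum>r\<in>UNIV. \<bar>A $ r $ s\<bar>) * \<bar>v $ s\<bar>)"
    by (subst sum.swap) (simp add: sum_distrib_right)
  also have "\<dots> \<le> (\<Sum>s\<in>UNIV. C * \<bar>v $ s\<bar>)"
    by (intro sum_mono mult_right_mono assms) auto
  finally show ?thesis by (simp add: l1_norm_def sum_distrib_left)
qed

lemma matrix_entry: "A $ r $ s = (A *v axis s 1) $ r"
  for A :: "real ^ 'n ^ 'm"
  by (simp add: matrix_vector_mult_basis column_def)

section \<open>Distance of f_e(A) from the identity\<close>

lemma l1_norm_matrix_power_le:
  assumes "\<And>v. l1_norm (A *v v) \<le> x * l1_norm v" and "x \<ge> 0"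
  shows "l1_norm (matrix_power A k *v v) \<le> x ^ k * l1_norm v"
proof (induction k)
  case (Suc k)
  have "l1_norm (matrix_power A (Suc k) *v v) \<le> x * l1_norm (matrix_power A k *v v)"
    using assms(1)[of "matrix_power A k *v v"] by (simp add: matrix_vector_mul_assoc)
  also have "\<dots> \<le> x * (x ^ k * l1_norm v)"
    by (rule mult_left_mono[OF Suc assms(2)])
  finally show ?case by (simp add: mult.assoc)
qed simp

lemma summable_matrixI:
  fixes f :: "nat \<Rightarrow> real ^ 'n ^ 'm"
  assumes "\<And>r s. summable (\<lambda>k. f k $ r $ s)"
  shows "summable f"
proof -
  have "f sums (\<chi> r s. \<Sum>k. f k $ r $ s)"
    unfolding sums_def
    by (intro vec_tendstoI) (simp add: summable_LIMSEQ assms)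
  then show ?thesis by (rule sums_summable)
qed

lemma two_power_le_fact_Suc: "(2::real) ^ k \<le> fact (Suc k)"
proof (induction k)
  case (Suc k)
  have "(2::real) * 2 ^ k \<le> real (Suc (Suc k)) * fact (Suc k)"
    by (rule mult_mono[OF _ Suc]) auto
  then show ?case by (simp only: fact_Suc[of "Suc k"] power_Suc)
qed simp

text \<open>
  The \<open>k\<close>-th Taylor coefficient of \<open>f_e\<close> has modulus \<open>1 / (k + 1)! \<le> 1 / 2\<^sup>k\<close>, and the constant
  term is \<open>1\<close>.  What remains after removing the identity is therefore dominated by
  \<open>\<Sum>k\<ge>1. (x / 2)\<^sup>k = x / (2 - x)\<close>.  This comparison is also what makes the matrix series converge.
\<close>

lemma l1_norm_diff_matrix_function_f_e_le:
  fixes A :: "real ^ 'n ^ 'n"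
  assumes A: "\<And>v. l1_norm (A *v v) \<le> x * l1_norm v" and x: "0 \<le> x" "x < 2"
  shows "l1_norm (v - matrix_function f_e A *v v) \<le> x / (2 - x) * l1_norm v"
proof -
  define a :: "nat \<Rightarrow> real" where "a k = (- 1) ^ k / fact (Suc k)" for k
  have a_abs: "\<bar>a k\<bar> \<le> (1 / 2) ^ k" for k
    using two_power_le_fact_Suc[of k]
    by (simp add: a_def abs_mult power_abs field_simps del: fact_Suc)
  have term_le: "l1_norm ((a k *\<^sub>R matrix_power A k) *v w) \<le> (x / 2) ^ k * l1_norm w" for k w
  proof -
    have "l1_norm ((a k *\<^sub>R matrix_power A k) *v w) = \<bar>a k\<bar> * l1_norm (matrix_power A k *v w)"
      by (simp add: scaleR_matrix_vector_assoc[symmetric] l1_norm_scaleR)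
    also have "\<dots> \<le> (1 / 2) ^ k * (x ^ k * l1_norm w)"
      by (intro mult_mono a_abs l1_norm_matrix_power_le A x l1_norm_nonneg) auto
    finally show ?thesis by (simp add: power_divide)
  qed
  have geom: "summable (\<lambda>k. (x / 2) ^ k)"
    using x by (intro summable_geometric) auto
  \<comment> \<open>An entry of a matrix is a component of its image of a unit vector, so the bound on the
    terms bounds their entries.\<close>
  have "summable (\<lambda>k. a k *\<^sub>R matrix_power A k)"
  proof (rule summable_matrixI)
    fix r s
    show "summable (\<lambda>k. (a k *\<^sub>R matrix_power A k) $ r $ s)"
    proof (rule summable_comparison_test[OF _ geom], intro exI allI impI)
      fix k
      have "norm ((a k *\<^sub>R matrix_power A k) $ r $ s)
          \<le> l1_norm ((a k *\<^sub>R matrix_power A k) *v axis s 1)"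
        by (subst matrix_entry) (simp only: real_norm_def abs_component_le_l1_norm)
      then show "norm ((a k *\<^sub>R matrix_power A k) $ r $ s) \<le> (x / 2) ^ k"
        using term_le[of k "axis s 1"] by (simp add: l1_norm_axis)
    qed
  qed
  then have "(\<lambda>k. a k *\<^sub>R matrix_power A k) sums matrix_function f_e A"
    by (simp add: matrix_function_def f_e_deriv a_def summable_sums del: fact_Suc)
  moreover have "bounded_linear (\<lambda>B :: real ^ 'n ^ 'n. B *v v)"
    by (intro linear_linear[THEN iffD2] linearI)
      (simp_all add: matrix_vector_mult_add_rdistrib scaleR_matrix_vector_assoc)
  ultimately have "(\<lambda>k. (a k *\<^sub>R matrix_power A k) *v v) sums (matrix_function f_e A *v v)"
    by (rule bounded_linear.sums[rotated])
  then have "(\<lambda>k. (a (Suc k) *\<^sub>R matrix_power A (Suc k)) *v v) sums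
      (matrix_function f_e A *v v - v)"
    by (subst sums_Suc_iff) (simp add: a_def)
  then have "(\<lambda>n. l1_norm (\<Sum>k<n. (a (Suc k) *\<^sub>R matrix_power A (Suc k)) *v v))
      \<longlonglongrightarrow> l1_norm (matrix_function f_e A *v v - v)"
    unfolding sums_def l1_norm_def by (intro tendsto_intros) auto
  moreover have "l1_norm (\<Sum>k<n. (a (Suc k) *\<^sub>R matrix_power A (Suc k)) *v v)
      \<le> x / (2 - x) * l1_norm v" for n
  proof -
    have "l1_norm (\<Sum>k<n. (a (Suc k) *\<^sub>R matrix_power A (Suc k)) *v v)
        \<le> (\<Sum>k<n. (x / 2) ^ Suc k * l1_norm v)"
      by (intro order_trans[OF l1_norm_sum] sum_mono term_le)
    also have "\<dots> = (x / 2) * (\<Sum>k<n. (x / 2) ^ k) * l1_norm v"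
      by (simp add: sum_distrib_left sum_distrib_right mult.assoc)
    also have "\<dots> \<le> (x / 2) * (1 / (1 - x / 2)) * l1_norm v"
      using x suminf_geometric[of "x / 2"] sum_le_suminf[OF geom, of "{..<n}"]
      by (intro mult_right_mono mult_left_mono l1_norm_nonneg) auto
    also have "(x / 2) * (1 / (1 - x / 2)) = x / (2 - x)"
      using x by (simp add: field_simps)
    finally show ?thesis .
  qed
  ultimately have "l1_norm (matrix_function f_e A *v v - v) \<le> x / (2 - x) * l1_norm v"
    by (intro LIMSEQ_le_const2) auto
  moreover have "l1_norm (matrix_function f_e A *v v - v) = l1_norm (v - matrix_function f_e A *v v)"
    by (simp add: l1_norm_def abs_minus_commute)
  ultimately show ?thesis by simp
qed

section \<open>Implicit Euler steps of a Markov generator\<close>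

text \<open>
  The convention is that of a generator acting on densities (column vectors): \<open>M $ r $ s\<close> is the
  rate of jumps from \<open>s\<close> to \<open>r\<close>, so conservation of mass is a condition on columns.
\<close>

definition markov_generator :: "real ^ 'n ^ 'n \<Rightarrow> bool" where
  "markov_generator M \<longleftrightarrow>
    (\<forall>r s. r \<noteq> s \<longrightarrow> M $ r $ s \<ge> 0) \<and> (\<forall>s. (\<Sum>r\<in>UNIV. M $ r $ s) = 0)"

lemma markov_generator_sum:
  assumes "markov_generator M"
  shows "(\<Sum>r\<in>UNIV. (M *v f) $ r) = 0"
proof -
  have "(\<Sum>r\<in>UNIV. (M *v f) $ r) = (\<Sum>s\<in>UNIV. (\<Sum>r\<in>UNIV. M $ r $ s) * f $ s)"
    unfolding matrix_vector_mult_def by (simp add: sum_distrib_right) (rule sum.swap)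
  then show ?thesis using assms by (simp add: markov_generator_def)
qed

lemma implicit_euler_component:
  "((mat 1 - t *\<^sub>R M) *v f) $ r = f $ r - t * (M *v f) $ r"
  for M :: "real ^ 'n ^ 'n"
  by (simp add: matrix_vector_mult_diff_rdistrib scaleR_matrix_vector_assoc[symmetric])

lemma implicit_euler_sum:
  assumes "markov_generator M"
  shows "(\<Sum>r\<in>UNIV. ((mat 1 - t *\<^sub>R M) *v f) $ r) = (\<Sum>r\<in>UNIV. f $ r)"
  using markov_generator_sum[OF assms, of f]
  by (simp add: implicit_euler_component sum_subtractf sum_distrib_left[symmetric])

text \<open>
  Kato's inequality: \<open>sgn(f) (M f) \<le> M |f|\<close> componentwise, because replacing \<open>sgn(f\<^sub>r) f\<^sub>s\<close> by
  \<open>|f\<^sub>s|\<close> changes nothing on the diagonal and increases the terms with off-diagonal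
  coefficients.  Summation over the components removes \<open>M |f|\<close>, as \<open>M\<close> conserves mass.
\<close>

lemma l1_norm_le_implicit_euler:
  assumes M: "markov_generator M" and t: "t \<ge> 0"
  shows "l1_norm f \<le> l1_norm ((mat 1 - t *\<^sub>R M) *v f)"
proof -
  define g where "g = (\<chi> s. \<bar>f $ s\<bar>)"
  have pointwise: "\<bar>f $ r\<bar> \<le> \<bar>((mat 1 - t *\<^sub>R M) *v f) $ r\<bar> + t * (M *v g) $ r" for r
  proof -
    define \<sigma> :: real where "\<sigma> = (if f $ r \<ge> 0 then 1 else - 1)"
    have \<sigma>: "\<sigma> * f $ r = \<bar>f $ r\<bar>" "\<And>z. \<sigma> * z \<le> \<bar>z\<bar>"
      by (auto simp: \<sigma>_def)
    have "\<sigma> * (M *v f) $ r = (\<Sum>s\<in>UNIV. M $ r $ s * (\<sigma> * f $ s))"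
      by (simp add: matrix_vector_mult_def sum_distrib_left mult.left_commute)
    also have "\<dots> \<le> (\<Sum>s\<in>UNIV. M $ r $ s * \<bar>f $ s\<bar>)"
    proof (rule sum_mono)
      fix s
      show "M $ r $ s * (\<sigma> * f $ s) \<le> M $ r $ s * \<bar>f $ s\<bar>"
        using \<sigma> M by (cases "s = r") (auto simp: markov_generator_def intro!: mult_left_mono)
    qed
    also have "\<dots> = (M *v g) $ r" by (simp add: matrix_vector_mult_def g_def)
    finally have "t * (\<sigma> * (M *v f) $ r) \<le> t * (M *v g) $ r"
      by (rule mult_left_mono[OF _ t])
    moreover have "\<bar>f $ r\<bar> = \<sigma> * ((mat 1 - t *\<^sub>R M) *v f) $ r + t * (\<sigma> * (M *v f) $ r)"
      unfolding implicit_euler_component \<sigma>(1)[symmetric]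
      by (simp only: right_diff_distrib mult.left_commute diff_add_cancel)
    ultimately show ?thesis using \<sigma>(2)[of "((mat 1 - t *\<^sub>R M) *v f) $ r"] by linarith
  qed
  have "l1_norm f \<le> l1_norm ((mat 1 - t *\<^sub>R M) *v f) + t * (\<Sum>r\<in>UNIV. (M *v g) $ r)"
    unfolding l1_norm_def sum_distrib_left sum.distrib[symmetric] by (intro sum_mono pointwise)
  then show ?thesis by (simp add: markov_generator_sum[OF M])
qed

lemma implicit_euler_invertible:
  assumes "markov_generator M" and "t \<ge> 0"
  shows "invertible (mat 1 - t *\<^sub>R M)"
proof -
  have "f = 0" if "(mat 1 - t *\<^sub>R M) *v f = 0" for f
  proof -
    have "l1_norm f \<le> 0"
      using l1_norm_le_implicit_euler[OF assms, of f] by (simp add: that)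
    then show ?thesis using l1_norm_nonneg[of f] l1_norm_eq_0_iff[of f] by simp
  qed
  then show ?thesis
    by (simp add: invertible_left_inverse matrix_left_invertible_ker)
qed

lemma matrix_inv_inverse:
  assumes "invertible A"
  shows "A ** matrix_inv A = mat 1" and "matrix_inv A ** A = mat 1"
  using someI_ex[OF assms[unfolded invertible_def]] by (simp_all add: matrix_inv_def)

text \<open>
  A column \<open>f\<close> of the inverse solves \<open>(I - t M) f = e\<^sub>s\<close>.  Mass conservation gives \<open>f\<close> total
  mass \<open>1\<close>, while the norm estimate gives \<open>|f|\<^sub>1 \<le> |e\<^sub>s|\<^sub>1 = 1\<close>.  A vector whose \<open>\<ell>\<^sup>1\<close> norm does
  not exceed its total mass has no negative component.
\<close>

lemma implicit_euler_inverse_stochastic: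
  assumes M: "markov_generator M" and t: "t \<ge> 0"
  shows "matrix_inv (mat 1 - t *\<^sub>R M) $ r $ s \<ge> 0"
    and "(\<Sum>r\<in>UNIV. matrix_inv (mat 1 - t *\<^sub>R M) $ r $ s) = 1"
proof -
  define f where "f = column s (matrix_inv (mat 1 - t *\<^sub>R M))"
  have f_nth: "matrix_inv (mat 1 - t *\<^sub>R M) $ i $ s = f $ i" for i
    by (simp add: f_def column_def)
  have f: "(mat 1 - t *\<^sub>R M) *v f = axis s 1"
    unfolding f_def matrix_vector_mult_basis[symmetric]
    by (simp add: matrix_vector_mul_assoc matrix_inv_inverse(1) implicit_euler_invertible[OF M t])
  have sum_f: "(\<Sum>i\<in>UNIV. f $ i) = 1"
    using implicit_euler_sum[OF M, of t f] unfolding f by (simp add: axis_def)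
  have "(\<Sum>i\<in>UNIV. \<bar>f $ i\<bar> - f $ i) \<le> 0"
    using l1_norm_le_implicit_euler[OF M t, of f] sum_f
    unfolding f l1_norm_axis by (simp add: l1_norm_def sum_subtractf)
  moreover have "(\<Sum>i\<in>UNIV. \<bar>f $ i\<bar> - f $ i) \<ge> \<bar>f $ r\<bar> - f $ r"
    by (rule member_le_sum) auto
  ultimately show "matrix_inv (mat 1 - t *\<^sub>R M) $ r $ s \<ge> 0"
    unfolding f_nth by linarith
  show "(\<Sum>r\<in>UNIV. matrix_inv (mat 1 - t *\<^sub>R M) $ r $ s) = 1"
    unfolding f_nth by (rule sum_f)
qed

lemma stochastic_entry_le_1:
  fixes P :: "real ^ 'n ^ 'n"
  assumes "\<And>r s. P $ r $ s \<ge> 0" and "\<And>s. (\<Sum>r\<in>UNIV. P $ r $ s) = 1"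
  shows "P $ r $ s \<le> 1"
  using member_le_sum[of r UNIV "\<lambda>r. P $ r $ s"] assms by simp

text \<open>
  Column \<open>s\<close> of \<open>P - I\<close> has diagonal part \<open>P\<^sub>s\<^sub>s - 1 \<le> 0\<close> and off-diagonal mass \<open>1 - P\<^sub>s\<^sub>s\<close>, hence
  norm \<open>2 (1 - P\<^sub>s\<^sub>s)\<close>.  The gain \<open>1 - \<alpha>\<close> over the trivial bound \<open>2\<close> is needed later: with \<open>2\<close>
  alone the perturbation estimate would demand a smaller time step.
\<close>

lemma l1_norm_stochastic_minus_id_le:
  fixes P :: "real ^ 'n ^ 'n"
  assumes nonneg: "\<And>r s. P $ r $ s \<ge> 0" and sum1: "\<And>s. (\<Sum>r\<in>UNIV. P $ r $ s) = 1"
    and \<alpha>: "\<And>s. \<alpha> \<le> P $ s $ s"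
  shows "l1_norm (P *v y - y) \<le> 2 * (1 - \<alpha>) * l1_norm y"
proof -
  have "(\<Sum>r\<in>UNIV. \<bar>(P - mat 1) $ r $ s\<bar>) \<le> 2 * (1 - \<alpha>)" for s
  proof -
    have "(\<Sum>r\<in>UNIV. \<bar>(P - mat 1) $ r $ s\<bar>)
        = (\<Sum>r\<in>UNIV. P $ r $ s + (if r = s then 1 - 2 * P $ s $ s else 0))"
      using nonneg stochastic_entry_le_1[OF nonneg sum1, of s s]
      by (intro sum.cong) (auto simp: mat_def)
    also have "\<dots> = 2 * (1 - P $ s $ s)"
      by (simp add: sum.distrib sum1)
    finally show ?thesis using \<alpha>[of s] by simp
  qed
  from l1_norm_matrix_vector_mult_le[of "P - mat 1", OF this]
  show ?thesis by (simp add: matrix_vector_mult_diff_rdistrib)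
qed

text \<open>
  In terms of \<open>y = (I - t M) u\<close> the defect \<open>w = c - y\<close> is \<open>(I - S)(P - I) y\<close>, so
  \<open>|w|\<^sub>1 \<le> e |y|\<^sub>1 \<le> e (|c|\<^sub>1 + |w|\<^sub>1)\<close> with \<open>e = 2 (1 - \<alpha>) \<delta>\<close>.  The smallness condition is
  \<open>e / (1 - e) < \<alpha>\<close> without denominators; it yields \<open>|w|\<^sub>1 < \<alpha> |c|\<^sub>1\<close>, and the lower bound
  \<open>\<alpha>\<close> on the entries of \<open>P\<close> makes \<open>P c\<close> outweigh \<open>P w\<close> in each component.
\<close>

lemma perturbed_implicit_euler_positive:
  fixes M S :: "real ^ 'n ^ 'n"
  assumes M: "markov_generator M" and t: "t \<ge> 0"
    and step: "u = c + t *\<^sub>R (S *v (M *v u))"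
    and c: "\<And>p. c $ p > 0"
    and \<alpha>: "\<alpha> > 0" "\<And>r s. \<alpha> \<le> matrix_inv (mat 1 - t *\<^sub>R M) $ r $ s"
    and S: "\<And>v. l1_norm (v - S *v v) \<le> \<delta> * l1_norm v" "\<delta> \<ge> 0"
    and small: "2 * (1 - \<alpha>) * (1 + \<alpha>) * \<delta> < \<alpha>"
  shows "u $ p > 0"
proof -
  define P where "P = matrix_inv (mat 1 - t *\<^sub>R M)"
  define y where "y = (mat 1 - t *\<^sub>R M) *v u"
  define w where "w = c - y"
  have P: "\<And>r s. P $ r $ s \<ge> 0" "\<And>s. (\<Sum>r\<in>UNIV. P $ r $ s) = 1" "\<And>r s. \<alpha> \<le> P $ r $ s"
    using implicit_euler_inverse_stochastic[OF M t] \<alpha> by (auto simp: P_def)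
  have P_le_1: "P $ r $ s \<le> 1" for r s
    by (rule stochastic_entry_le_1[OF P(1,2)])
  have "P ** (mat 1 - t *\<^sub>R M) = mat 1"
    unfolding P_def by (rule matrix_inv_inverse(2)[OF implicit_euler_invertible[OF M t]])
  then have u: "u = P *v y"
    by (simp only: y_def matrix_vector_mul_assoc matrix_vector_mul_lid)
  have incr: "P *v y - y = t *\<^sub>R (M *v u)"
    unfolding u[symmetric] unfolding y_def
    by (simp add: matrix_vector_mult_diff_rdistrib scaleR_matrix_vector_assoc)
  have w: "w = (P *v y - y) - S *v (P *v y - y)"
  proof -
    have "S *v (P *v y - y) = u - c"
      by (subst step) (simp add: incr matrix_vector_mult_scaleR)
    then show ?thesis by (simp add: w_def u[symmetric])
  qed
  define e where "e = 2 * (1 - \<alpha>) * \<delta>"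
  have e_nonneg: "e \<ge> 0"
    using P(3)[of p p] P_le_1[of p p] S(2) by (simp add: e_def)
  have "l1_norm w \<le> \<delta> * l1_norm (P *v y - y)"
    unfolding w by (rule S)
  also have "\<dots> \<le> \<delta> * (2 * (1 - \<alpha>) * l1_norm y)"
    by (intro mult_left_mono l1_norm_stochastic_minus_id_le P S)
  also have "\<dots> = e * l1_norm y" by (simp add: e_def)
  also have "\<dots> \<le> e * (l1_norm c + l1_norm w)"
    using l1_norm_diff[of c w] by (intro mult_left_mono e_nonneg) (simp add: w_def)
  finally have w_le: "(1 - e) * l1_norm w \<le> e * l1_norm c"
    by (simp add: algebra_simps)
  have e_less: "e < (1 - e) * \<alpha>"
    using small by (simp add: e_def algebra_simps)
  then have "1 - e > 0"
    using e_nonneg \<alpha>(1) by (metis le_less_trans zero_less_mult_pos2)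
  have "l1_norm c > 0"
    using c[of p] abs_component_le_l1_norm[of c p] by linarith
  with e_less have "e * l1_norm c < (1 - e) * (\<alpha> * l1_norm c)"
    by (simp flip: mult.assoc)
  with w_le have "(1 - e) * l1_norm w < (1 - e) * (\<alpha> * l1_norm c)" by linarith
  with \<open>1 - e > 0\<close> have "l1_norm w < \<alpha> * l1_norm c" by simp
  also have "\<dots> = (\<Sum>s\<in>UNIV. \<alpha> * c $ s)"
    using c by (simp add: l1_norm_def sum_distrib_left abs_of_pos)
  also have "\<dots> \<le> (\<Sum>s\<in>UNIV. P $ p $ s * c $ s)"
    using c by (intro sum_mono mult_right_mono P) (auto intro: less_imp_le)
  also have "\<dots> = (P *v c) $ p" by (simp add: matrix_vector_mult_def)
  finally have *: "l1_norm w < (P *v c) $ p" .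
  have "(P *v w) $ p \<le> l1_norm w"
    unfolding matrix_vector_mult_def l1_norm_def vec_lambda_beta
  proof (rule sum_mono)
    fix s
    have "P $ p $ s * w $ s \<le> P $ p $ s * \<bar>w $ s\<bar>" by (intro mult_left_mono P) simp
    also have "\<dots> \<le> 1 * \<bar>w $ s\<bar>" by (intro mult_right_mono P_le_1) simp
    finally show "P $ p $ s * w $ s \<le> \<bar>w $ s\<bar>" by simp
  qed
  with * have "(P *v c) $ p - (P *v w) $ p > 0" by linarith
  moreover have "u = P *v c - P *v w"
    by (simp add: u w_def matrix_vector_mult_diff_distrib)
  ultimately show ?thesis by simp
qed

section \<open>The grid operators\<close>

lemma east_west: "east (west p) = p" and west_east: "west (east p) = p"
  and north_south: "north (south p) = p" and south_north: "south (north p) = p"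
  for p :: "('x::finite, 'y::finite) cell"
  by (simp_all add: east_def west_def north_def south_def)

lemma bij_east: "bij east" and bij_west: "bij west"
  and bij_north: "bij north" and bij_south: "bij south"
  by (rule o_bij[of west], simp_all add: fun_eq_iff east_west west_east,
      rule o_bij[of east], simp_all add: fun_eq_iff east_west west_east,
      rule o_bij[of south], simp_all add: fun_eq_iff north_south south_north,
      rule o_bij[of north], simp_all add: fun_eq_iff north_south south_north)

lemma Bernoulli_nonneg: "Bernoulli z \<ge> 0"
  by (cases "z \<ge> 0") (auto simp: Bernoulli_def intro: divide_nonneg_nonneg divide_nonpos_nonpos)

text \<open>
  Off the diagonal only the values of \<open>f\<close> at the four neighbours enter \<open>(M f)\<^sub>r\<close>, with Bernoulli
  weights; the column sums vanish because the flux differences telescope on a periodic grid.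
  Testing with unit vectors covers grids with one or two cells in a direction as well, where
  neighbours coincide with each other or with the cell.
\<close>

lemma markov_generator_M_h:
  fixes dgx dgy :: "('x::finite, 'y::finite) grid"
  assumes "\<kappa> \<ge> 0" and "h > 0"
  shows "markov_generator (M_h \<kappa> h dgx dgy)"
  unfolding markov_generator_def
proof (intro conjI allI impI)
  fix r s :: "('x, 'y) cell"
  assume "r \<noteq> s"
  then have "axis s (1::real) $ r = 0" by (simp add: axis_def)
  then have "M_h \<kappa> h dgx dgy $ r $ s = \<kappa> / h\<^sup>2 *
      (Bernoulli (- (dgx $ r)) * axis s 1 $ east r + Bernoulli (dgx $ west r) * axis s 1 $ west r
       + Bernoulli (- (dgy $ r)) * axis s 1 $ north r + Bernoulli (dgy $ south r) * axis s 1 $ south r)"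
    using assms
    by (simp add: matrix_entry[of "M_h \<kappa> h dgx dgy"] M_h_mult flux_x_def flux_y_def
        east_west north_south field_simps power2_eq_square)
  also have "\<dots> \<ge> 0"
    using assms by (intro mult_nonneg_nonneg add_nonneg_nonneg Bernoulli_nonneg) (auto simp: axis_def)
  finally show "M_h \<kappa> h dgx dgy $ r $ s \<ge> 0" .
next
  fix s :: "('x, 'y) cell"
  have "(\<Sum>p\<in>UNIV. F $ west p) = (\<Sum>p\<in>UNIV. F $ p)"
    "(\<Sum>p\<in>UNIV. F $ south p) = (\<Sum>p\<in>UNIV. F $ p)" for F :: "('x, 'y) grid"
    using sum.reindex_bij_betw[OF bij_west] sum.reindex_bij_betw[OF bij_south] by blast+
  then show "(\<Sum>r\<in>UNIV. M_h \<kappa> h dgx dgy $ r $ s) = 0"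
    by (simp add: matrix_entry[of "M_h \<kappa> h dgx dgy"] M_h_mult sum_subtractf
        sum_negf sum_divide_distrib[symmetric])
qed

lemma l1_norm_L_h_le:
  fixes v :: "('x::finite, 'y::finite) grid"
  assumes "\<kappa> \<ge> 0" and "stab \<ge> 0"
  shows "l1_norm (L_h \<kappa> stab h *v v) \<le> (8 * \<kappa> / h\<^sup>2 + stab) * l1_norm v"
proof -
  have shift: "(\<Sum>p\<in>UNIV. \<bar>v $ east p\<bar>) = l1_norm v" "(\<Sum>p\<in>UNIV. \<bar>v $ west p\<bar>) = l1_norm v"
    "(\<Sum>p\<in>UNIV. \<bar>v $ north p\<bar>) = l1_norm v" "(\<Sum>p\<in>UNIV. \<bar>v $ south p\<bar>) = l1_norm v"
    unfolding l1_norm_def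
    using sum.reindex_bij_betw[OF bij_east, of "\<lambda>p. \<bar>v $ p\<bar>"]
      sum.reindex_bij_betw[OF bij_west, of "\<lambda>p. \<bar>v $ p\<bar>"]
      sum.reindex_bij_betw[OF bij_north, of "\<lambda>p. \<bar>v $ p\<bar>"]
      sum.reindex_bij_betw[OF bij_south, of "\<lambda>p. \<bar>v $ p\<bar>"] by auto
  have "l1_norm (discrete_laplacian h v) \<le> (\<Sum>p\<in>UNIV. (\<bar>v $ east p\<bar> + \<bar>v $ west p\<bar>
      + \<bar>v $ north p\<bar> + \<bar>v $ south p\<bar> + 4 * \<bar>v $ p\<bar>) / h\<^sup>2)"
    unfolding l1_norm_def discrete_laplacian_def
    by (intro sum_mono) (auto simp: intro!: divide_right_mono)
  also have "\<dots> = 8 / h\<^sup>2 * l1_norm v"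
    by (simp add: sum_divide_distrib[symmetric] sum.distrib shift sum_distrib_left[symmetric]
        l1_norm_def[of v, symmetric])
  finally have "\<kappa> * l1_norm (discrete_laplacian h v) \<le> \<kappa> * (8 / h\<^sup>2 * l1_norm v)"
    by (rule mult_left_mono[OF _ assms(1)])
  moreover have "l1_norm (L_h \<kappa> stab h *v v)
      \<le> \<kappa> * l1_norm (discrete_laplacian h v) + stab * l1_norm v"
    unfolding L_h_mult
    using l1_norm_triangle[of "- \<kappa> *\<^sub>R discrete_laplacian h v" "stab *\<^sub>R v"] assms
    by (simp only: l1_norm_scaleR abs_minus_cancel abs_of_nonneg)
  ultimately show ?thesis by (simp add: algebra_simps)
qed

lemma alpha_min_le_entry:
  fixes M :: "'l::finite \<Rightarrow> ('x::finite, 'y::finite) grid_matrix"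
  shows "alpha_min t M \<le> matrix_inv (mat 1 - t *\<^sub>R M l) $ r $ s"
  and alpha_min_attained: "\<exists>l r s. alpha_min t M = matrix_inv (mat 1 - t *\<^sub>R M l) $ r $ s"
proof -
  let ?E = "{matrix_inv (mat 1 - t *\<^sub>R M l) $ r $ s | l r s. True}"
  have "?E = (\<Union>l. \<Union>r. \<Union>s. {matrix_inv (mat 1 - t *\<^sub>R M l) $ r $ s})"
    by blast
  then have fin: "finite ?E" by simp
  show "alpha_min t M \<le> matrix_inv (mat 1 - t *\<^sub>R M l) $ r $ s"
    unfolding alpha_min_def by (rule Min_le[OF fin]) blast
  have "alpha_min t M \<in> ?E"
    unfolding alpha_min_def by (rule Min_in[OF fin]) blast
  then show "\<exists>l r s. alpha_min t M = matrix_inv (mat 1 - t *\<^sub>R M l) $ r $ s"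
    by blast
qed

theorem theorem2:
  fixes Lx Ly h \<Delta>t \<kappa> stab v0 chi0 :: real
    and q v a :: "'l::finite \<Rightarrow> real"
    and \<epsilon> \<epsilon>x \<epsilon>y Dx Dy :: "('x::finite, 'y::finite) grid"
    and c c_new \<mu> dgx dgy :: "'l \<Rightarrow> ('x, 'y) grid"
    and M :: "'l \<Rightarrow> ('x, 'y) grid_matrix"
  assumes "Lx > 0" and "Ly > 0"
    and "h = Lx / real CARD('x)" and "h = Ly / real CARD('y)"
    and "\<kappa> > 0" and "stab > 0" and "v0 > 0" and "\<And>l. a l > 0"
    and "\<And>p. \<epsilon> $ p > 0" and "\<And>p. \<epsilon>x $ p > 0" and "\<And>p. \<epsilon>y $ p > 0"
    and "\<And>l p. c l $ p > 0"
    and "\<And>p. solvent_concentration v v0 c $ p > 0"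
    and "\<And>l. \<mu> l = excess_potential v v0 chi0 q a \<epsilon> c l"
    and "\<And>l. dgx l = dg_x h (q l) Dx \<epsilon>x (\<mu> l)"
    and "\<And>l. dgy l = dg_y h (q l) Dy \<epsilon>y (\<mu> l)"
    and "\<And>l. M l = M_h \<kappa> h (dgx l) (dgy l)"
    and "\<Delta>t > 0" and "h > 0"
    and "\<Delta>t / h\<^sup>2 < 1 / (16 * \<kappa> * Bernoulli
           (- Max ({\<bar>dgx l $ p\<bar> | l p. True} \<union> {\<bar>dgy l $ p\<bar> | l p. True})))"
    and "(4 * \<kappa> / h\<^sup>2 + stab / 4) * \<Delta>t < alpha_min \<Delta>t M / (4 + 2 * alpha_min \<Delta>t M)"
    and "\<And>l. c_new l = c l + \<Delta>t *\<^sub>R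
           (matrix_function f_e (\<Delta>t *\<^sub>R L_h \<kappa> stab h) *v (M l *v c_new l))"
  shows "\<forall>l p. c_new l $ p > 0"
proof (intro allI)
  fix l p
  define \<alpha> where "\<alpha> = alpha_min \<Delta>t M"
  define x where "x = \<Delta>t * (8 * \<kappa> / h\<^sup>2 + stab)"
  have gen: "markov_generator (M l')" for l'
    unfolding assms(17) using assms(5,19) by (intro markov_generator_M_h) auto
  have "\<alpha> \<ge> 0"
    using alpha_min_attained[of \<Delta>t M] implicit_euler_inverse_stochastic(1)[OF gen, of \<Delta>t] assms(18)
    unfolding \<alpha>_def by fastforce
  have x_pos: "x > 0"
    unfolding x_def using assms(5,6,18) by (intro mult_pos_pos add_nonneg_pos) auto
  \<comment> \<open>Four times the left side of the time step bound is \<open>\<Delta>t (16 \<kappa> / h\<^sup>2 + \<lambda>)\<close>.\<close>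
  have "x \<le> 4 * ((4 * \<kappa> / h\<^sup>2 + stab / 4) * \<Delta>t)"
  proof -
    have "4 * ((4 * \<kappa> / h\<^sup>2 + stab / 4) * \<Delta>t) - x = 8 * (\<kappa> / h\<^sup>2) * \<Delta>t"
      unfolding x_def by (simp add: field_simps)
    also have "\<dots> \<ge> 0" using assms(5,18) by simp
    finally show ?thesis by simp
  qed
  with assms(21) have x_less: "x < 4 * (\<alpha> / (4 + 2 * \<alpha>))"
    unfolding \<alpha>_def by linarith
  with x_pos \<open>\<alpha> \<ge> 0\<close> have \<alpha>_pos: "\<alpha> > 0"
    by (cases "\<alpha> = 0") auto
  with x_less have x_bound: "x * (2 + \<alpha>) < 2 * \<alpha>"
    by (simp add: field_simps)
  then have "x * (2 + \<alpha>) < 2 * (2 + \<alpha>)" by simp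
  with \<alpha>_pos have x_less_2: "x < 2"
    by (intro mult_right_less_imp_less[of x "2 + \<alpha>" 2]) auto
  show "c_new l $ p > 0"
  proof (rule perturbed_implicit_euler_positive[OF gen])
    show "c_new l = c l + \<Delta>t *\<^sub>R (matrix_function f_e (\<Delta>t *\<^sub>R L_h \<kappa> stab h) *v (M l *v c_new l))"
      by (rule assms(22))
    show "\<alpha> \<le> matrix_inv (mat 1 - \<Delta>t *\<^sub>R M l) $ r $ s" for r s
      unfolding \<alpha>_def by (rule alpha_min_le_entry)
    have "l1_norm ((\<Delta>t *\<^sub>R L_h \<kappa> stab h) *v v) \<le> x * l1_norm v" for v :: "('x, 'y) grid"
    proof -
      have "\<Delta>t * l1_norm (L_h \<kappa> stab h *v v) \<le> \<Delta>t * ((8 * \<kappa> / h\<^sup>2 + stab) * l1_norm v)"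
        using assms(5,6,18) by (intro mult_left_mono l1_norm_L_h_le) auto
      then show ?thesis
        using assms(18)
        by (simp add: scaleR_matrix_vector_assoc[symmetric] l1_norm_scaleR x_def mult.assoc)
    qed
    then show "l1_norm (v - matrix_function f_e (\<Delta>t *\<^sub>R L_h \<kappa> stab h) *v v)
        \<le> x / (2 - x) * l1_norm v" for v :: "('x, 'y) grid"
      by (rule l1_norm_diff_matrix_function_f_e_le) (use x_pos x_less_2 in auto)
    \<comment> \<open>The factor \<open>(1 - \<alpha>) (1 + \<alpha>) \<le> 1\<close> reduces smallness to \<open>2 x < \<alpha> (2 - x)\<close>, which is
      the time step bound in the form \<open>x (2 + \<alpha>) < 2 \<alpha>\<close>.\<close>
    have "2 * (1 - \<alpha>) * (1 + \<alpha>) * x = 2 * x - 2 * \<alpha>\<^sup>2 * x"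
      by (simp add: algebra_simps power2_eq_square)
    also have "\<dots> \<le> 2 * x" using x_pos by simp
    also have "\<dots> < \<alpha> * (2 - x)" using x_bound by (simp add: algebra_simps)
    finally show "2 * (1 - \<alpha>) * (1 + \<alpha>) * (x / (2 - x)) < \<alpha>"
      using x_less_2 by (simp add: divide_less_eq)
  qed (use assms(12,18) \<alpha>_pos x_pos x_less_2 in auto)
qed

end
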